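(* Let $(X_j,d_j)$, $j\in\mathbb{N}$, be a sequence of precompact length metric spaces with precompact boundary. Suppose that there is a decreasing sequence $\{\delta_i\}_{i=1}^\infty$ of positive real numbers converging to zero such that $X_j^{\delta_i}\neq\emptyset$ for all $i,j$ and such that, for every $i$, the sequence $\{(\overline{X_j^{\delta_i}},d_j)\}_{j=1}^\infty$ converges in the Gromov-Hausdorff sense to some compact metric space $(X(\delta_i),d_{X(\delta_i)})$. Suppose that there is a compact metric space $(X_\partial,d_\partial)$ such that $(\partial X_j,d_j)$ converges to $(X_\partial,d_\partial)$ in the Gromov-Hausdorff sense as $j\to\infty$. Then a subsequence of $\{(\bar X_j,d_j)\}_{j=1}^\infty$ converges in the Gromov-Hausdorff sense.
   Context: For a metric space $(X,d)$, $\bar X$ denotes its metric completion (with the extended metric, still denoted $d$), and the boundary of $X$ is $\partial X:=\bar X\setminus X$. For $\delta>0$ the $\delta$-inner region is $X^\delta:=\{x\in X: d(x,\partial X)>\delta\}$; $\overline{X^\delta}$ is its closure in $\bar X$. All subsets of $\bar X_j$ carry the restriction of the metric $d_j$. A metric space is precompact if its completion is compact. *)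

theory Defs
  imports "HOL-Analysis.Analysis"
begin

section \<open>Metric completion, boundary and inner regions\<close>

text \<open>The completion is realised as the closure of the Kuratowski image of the space in the
  (complete) space of bounded real functions on it. The base point in \<open>mcompletion_embed\<close> is
  irrelevant up to isometry. The space is identified with its image under \<open>mcompletion_embed\<close>;
  the three lemmas below state that this is a completion.\<close>

definition mcompletion_embed :: "'a metric \<Rightarrow> 'a \<Rightarrow> 'a \<Rightarrow> real" where
  "mcompletion_embed m x =
     (\<lambda>u\<in>mspace m. mdist m x u - mdist m (SOME a. a \<in> mspace m) u)"

definition mcompletion :: "'a metric \<Rightarrow> ('a \<Rightarrow> real) metric" where
  "mcompletion m =
     submetric (funspace (mspace m) euclidean_metric)
       (mtopology_of (funspace (mspace m) euclidean_metric) closure_of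
          (mcompletion_embed m ` mspace m))"

lemma mcompletion_embed_in_funspace:
  assumes "x \<in> mspace m"
  shows "mcompletion_embed m x \<in> mspace (funspace (mspace m) euclidean_metric)"
proof -
  interpret Metric_space "mspace m" "mdist m" by (rule Metric_space_mspace_mdist)
  define a where "a = (SOME a. a \<in> mspace m)"
  have a: "a \<in> mspace m"
    unfolding a_def using assms by (rule someI)
  have "\<bar>mdist m x c - mdist m a c\<bar> \<le> mdist m a x" if "c \<in> mspace m" for c
    using assms a that by (smt (verit, best) commute triangle'')
  then have "(\<lambda>u. mdist m x u - mdist m a u) ` mspace m \<subseteq> cball 0 (mdist m a x)"
    by force
  then have "bounded (mcompletion_embed m x ` mspace m)"
    unfolding mcompletion_embed_def a_def[symmetric]
    by (metis bounded_cball bounded_subset image_restrict_eq)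
  moreover have "mcompletion_embed m x \<in> extensional (mspace m)"
    by (simp add: mcompletion_embed_def)
  ultimately show ?thesis
    by (simp add: Met_TC.fspace_def)
qed

lemma mcomplete_of_mcompletion: "mcomplete_of (mcompletion m)"
proof -
  let ?F = "funspace (mspace m) (euclidean_metric :: real metric)"
  let ?S = "mtopology_of ?F closure_of (mcompletion_embed m ` mspace m)"
  have sub: "?S \<subseteq> mspace ?F"
    by (metis closure_of_subset_topspace topspace_mtopology_of)
  interpret S: Submetric "mspace ?F" "mdist ?F" ?S
    using sub by (simp add: Metric_space_mspace_mdist Submetric.intro Submetric_axioms_def
        del: mspace_funspace mdist_funspace)
  have "mcomplete_of ?F"
    using Metric_space.mcomplete_funspace Met_TC.Metric_space_axioms
    by (fastforce simp: mcomplete_of_def)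
  then have "S.mcomplete"
    by (simp add: mcomplete_of_def del: mspace_funspace mdist_funspace)
  moreover have "closedin S.mtopology ?S"
    by (metis closedin_closure_of mtopology_of_def)
  ultimately have "S.sub.mcomplete"
    using S.closedin_mcomplete_imp_mcomplete by blast
  then show ?thesis
    using sub
    by (simp add: mcompletion_def mcomplete_of_def Int_absorb2
        del: mspace_funspace mdist_funspace)
qed

lemma mdist_mcompletion_embed:
  assumes "x \<in> mspace m" "y \<in> mspace m"
  shows "mdist (mcompletion m) (mcompletion_embed m x) (mcompletion_embed m y) = mdist m x y"
proof -
  interpret Metric_space "mspace m" "mdist m" by (rule Metric_space_mspace_mdist)
  let ?f = "mcompletion_embed m"
  have "(SUP c\<in>mspace m. dist (?f x c) (?f y c)) = mdist m x y"
  proof (rule cSup_eq_maximum)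
    show "mdist m x y \<in> (\<lambda>c. dist (?f x c) (?f y c)) ` mspace m"
      using assms by (intro image_eqI[of _ _ y]) (auto simp: mcompletion_embed_def dist_real_def)
    show "z \<le> mdist m x y" if "z \<in> (\<lambda>c. dist (?f x c) (?f y c)) ` mspace m" for z
      using that assms
      by (auto simp: mcompletion_embed_def dist_real_def)
         (smt (verit, best) commute triangle')
  qed
  moreover have "?f x \<in> mspace (funspace (mspace m) euclidean_metric)"
    "?f y \<in> mspace (funspace (mspace m) euclidean_metric)"
    using assms by (simp_all add: mcompletion_embed_in_funspace del: mspace_funspace)
  ultimately show ?thesis
    using assms by (auto simp: mcompletion_def Met_TC.fdist_def)
qed

lemma mcompletion_dense:
  "mtopology_of (mcompletion m) closure_of (mcompletion_embed m ` mspace m)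
     = mspace (mcompletion m)"
proof -
  let ?F = "funspace (mspace m) (euclidean_metric :: real metric)"
  let ?E = "mcompletion_embed m ` mspace m"
  let ?S = "mtopology_of ?F closure_of ?E"
  have E: "?E \<subseteq> topspace (mtopology_of ?F)"
    using mcompletion_embed_in_funspace by (auto simp del: mspace_funspace)
  have sub: "?S \<subseteq> mspace ?F"
    by (metis closure_of_subset_topspace topspace_mtopology_of)
  have "?E \<subseteq> ?S"
    using E by (rule closure_of_subset)
  then show ?thesis
    using sub
    by (simp add: mcompletion_def mtopology_of_submetric closure_of_subtopology Int_absorb1 Int_absorb2
        del: mspace_funspace mdist_funspace)
qed

definition precompact_metric :: "'a metric \<Rightarrow> bool" where
  "precompact_metric m \<longleftrightarrow> compact_space (mtopology_of (mcompletion m))"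

definition mboundary :: "'a metric \<Rightarrow> ('a \<Rightarrow> real) set" where
  "mboundary m = mspace (mcompletion m) - mcompletion_embed m ` mspace m"

text \<open>The infimum is taken in the extended reals, so that the distance to an empty boundary
  is \<open>\<infinity>\<close> (and not \<open>0\<close>).\<close>

definition inner_region :: "'a metric \<Rightarrow> real \<Rightarrow> 'a set" where
  "inner_region m \<delta> =
     {x \<in> mspace m.
        ereal \<delta> < (INF b\<in>mboundary m. ereal (mdist (mcompletion m) (mcompletion_embed m x) b))}"

definition closed_inner_region :: "'a metric \<Rightarrow> real \<Rightarrow> ('a \<Rightarrow> real) set" where
  "closed_inner_region m \<delta> =
     mtopology_of (mcompletion m) closure_of (mcompletion_embed m ` inner_region m \<delta>)"


section \<open>Length spaces\<close>

definition curve_length :: "'a metric \<Rightarrow> (real \<Rightarrow> 'a) \<Rightarrow> ereal" where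
  "curve_length m \<gamma> =
     Sup {(\<Sum>i<n. ereal (mdist m (\<gamma> (t i)) (\<gamma> (t (Suc i))))) | (n::nat) (t::nat \<Rightarrow> real).
            t 0 = 0 \<and> t n = 1 \<and> (\<forall>i<n. t i \<le> t (Suc i))}"

text \<open>If two points are joined by no curve, the infimum is \<open>\<infinity>\<close> and the condition fails.\<close>

definition length_metric :: "'a metric \<Rightarrow> bool" where
  "length_metric m \<longleftrightarrow>
     (\<forall>x\<in>mspace m. \<forall>y\<in>mspace m.
        ereal (mdist m x y) =
          (INF \<gamma>\<in>{\<gamma>. pathin (mtopology_of m) \<gamma> \<and> \<gamma> 0 = x \<and> \<gamma> 1 = y}. curve_length m \<gamma>))"


section \<open>Gromov-Hausdorff convergence\<close>

definition Hausdorff_dist :: "'a metric \<Rightarrow> 'a set \<Rightarrow> 'a set \<Rightarrow> ereal" where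
  "Hausdorff_dist m A B =
     Inf {ereal r | r. r > 0 \<and> (\<forall>a\<in>A. \<exists>b\<in>B. mdist m a b < r) \<and> (\<forall>b\<in>B. \<exists>a\<in>A. mdist m a b < r)}"

definition isometric_embedding :: "'a metric \<Rightarrow> 'b metric \<Rightarrow> ('a \<Rightarrow> 'b) \<Rightarrow> bool" where
  "isometric_embedding m m' f \<longleftrightarrow>
     f \<in> mspace m \<rightarrow> mspace m' \<and>
     (\<forall>x\<in>mspace m. \<forall>y\<in>mspace m. mdist m' (f x) (f y) = mdist m x y)"

text \<open>The ambient spaces range over all metric spaces with carrier in the sum type. This is no
  restriction: the Hausdorff distance of the two images only depends on their union, and that
  union injects into the disjoint union of the two spaces.\<close>

definition GH_dist :: "'a metric \<Rightarrow> 'b metric \<Rightarrow> ereal" where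
  "GH_dist m1 m2 =
     Inf {Hausdorff_dist Z (f ` mspace m1) (g ` mspace m2) | (Z :: ('a + 'b) metric) f g.
            isometric_embedding m1 Z f \<and> isometric_embedding m2 Z g}"

definition GH_converges :: "(nat \<Rightarrow> 'a metric) \<Rightarrow> 'b metric \<Rightarrow> bool" where
  "GH_converges X Y \<longleftrightarrow> (\<lambda>j. GH_dist (X j) Y) \<longlonglongrightarrow> 0"

text \<open>A limit of an unspecified type is not expressible. Every compact metric space has at
  most the cardinality of the continuum, so it is isometric to one with carrier in
  \<^typ>\<open>nat \<Rightarrow> real\<close>, with an arbitrary metric (not the product one).\<close>

definition GH_convergent :: "(nat \<Rightarrow> 'a metric) \<Rightarrow> bool" where
  "GH_convergent X \<longleftrightarrow>
     (\<exists>Y :: (nat \<Rightarrow> real) metric. compact_space (mtopology_of Y) \<and> GH_converges X Y)"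

end

theory Submission
  imports Defs "HOL-Complex_Analysis.Great_Picard"
begin

text \<open>A point of \<open>X\<^sub>j\<close> outside the \<open>\<delta>\<close>-inner region is within about \<open>\<delta>\<close> of the boundary. Hence
  finite nets of the closed inner region and of the boundary, whose sizes are bounded uniformly
  in \<open>j\<close> by Gromov-Hausdorff convergence, combine to nets of the completion of uniformly bounded
  size. The length structure is needed only for connectedness, which turns a \<open>1\<close>-net of \<open>N\<close>
  points into a diameter bound of \<open>3N\<close>. The theorem then follows from Gromov's precompactness
  criterion: number points of finer and finer nets of each space, make all mutual distances
  converge by a diagonal argument, and complete the limiting pseudometric on the indices.\<close>

section \<open>Finite nets, compactness and diameter\<close>

definition has_net :: "'a metric \<Rightarrow> real \<Rightarrow> nat \<Rightarrow> bool" where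
  "has_net m e N \<longleftrightarrow>
     (\<exists>C\<subseteq>mspace m. finite C \<and> card C \<le> N \<and> (\<forall>x\<in>mspace m. \<exists>c\<in>C. mdist m x c < e))"

lemma has_net_mono:
  assumes "has_net m e N" "e \<le> e'" "N \<le> N'"
  shows "has_net m e' N'"
  using assms unfolding has_net_def by (meson le_trans order_less_le_trans)

lemma compact_has_net:
  assumes "compact_space (mtopology_of m)" "e > 0"
  shows "\<exists>N. has_net m e N"
proof -
  interpret Metric_space "mspace m" "mdist m" by (rule Metric_space_mspace_mdist)
  have "mtotally_bounded (mspace m)"
    using assms(1) compact_space_eq_mcomplete_mtotally_bounded by (simp add: mtopology_of_def)
  then obtain K where K: "finite K" "K \<subseteq> mspace m" "mspace m \<subseteq> (\<Union>x\<in>K. mball x e)"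
    using assms(2) unfolding mtotally_bounded_def by meson
  then have "\<exists>c\<in>K. mdist m x c < e" if "x \<in> mspace m" for x
    using that by (force simp: commute)
  with K show ?thesis
    unfolding has_net_def by blast
qed

text \<open>Completeness together with total boundedness gives compactness. This serves the limit
  space, which is complete by construction.\<close>

lemma compact_if_nets:
  assumes "mcomplete_of m" "\<And>e. e > 0 \<Longrightarrow> \<exists>N. has_net m e N"
  shows "compact_space (mtopology_of m)"
proof -
  interpret Metric_space "mspace m" "mdist m" by (rule Metric_space_mspace_mdist)
  have "mtotally_bounded (mspace m)"
    unfolding mtotally_bounded_def
  proof (intro allI impI)
    fix e :: real assume "e > 0"
    then obtain C where C: "C \<subseteq> mspace m" "finite C" "\<forall>x\<in>mspace m. \<exists>c\<in>C. mdist m x c < e"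
      using assms(2) unfolding has_net_def by meson
    then have "mspace m \<subseteq> (\<Union>c\<in>C. mball c e)"
      by (force simp: commute)
    with C show "\<exists>K. finite K \<and> K \<subseteq> mspace m \<and> mspace m \<subseteq> (\<Union>x\<in>K. mball x e)"
      by blast
  qed
  then show ?thesis
    using assms(1) compact_space_eq_mcomplete_mtotally_bounded
    by (simp add: mtopology_of_def mcomplete_of_def)
qed

text \<open>Along a connected set the distance from \<open>x\<close> takes the values \<open>0, 3e, 6e, \<dots>\<close> up to
  \<open>mdist m x y\<close>, and points realising different values need different net points.\<close>

lemma connected_net_diameter:
  assumes "connected_space (mtopology_of m)" "has_net m e N" "e > 0"
    and "x \<in> mspace m" "y \<in> mspace m"
  shows "mdist m x y \<le> 3 * e * N"
proof -
  \<comment> \<open>\<open>K\<close> is the number of full steps of length \<open>3 * e\<close>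
    between \<open>x\<close> and \<open>y\<close>; the multiples with \<open>k = 0, ..., K\<close>
    give \<open>K + 1\<close> points.\<close>
  define K where "K = nat \<lfloor>mdist m x y / (3 * e)\<rfloor>"
  have "connectedin (mtopology_of m) (mspace m)"
    using assms(1) by (metis connectedin_topspace topspace_mtopology_of)
  moreover have "continuous_map (mtopology_of m) euclidean (mdist m x)"
    by (simp add: assms(4) continuous_map_mdist)
  ultimately have "connected (mdist m x ` mspace m)"
    using connectedin_continuous_map_image by (metis connectedin_iff_connected)
  moreover have "0 \<in> mdist m x ` mspace m" "mdist m x y \<in> mdist m x ` mspace m"
    using assms(4,5) by (metis image_eqI mdist_zero, simp)
  ultimately have ivt: "t \<in> mdist m x ` mspace m" if "0 \<le> t" "t \<le> mdist m x y" for t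
    using that by (metis connectedD_interval)
  obtain C where C: "C \<subseteq> mspace m" "finite C" "card C \<le> N" "\<forall>x\<in>mspace m. \<exists>c\<in>C. mdist m x c < e"
    using assms(2) unfolding has_net_def by blast
  have "real K \<le> mdist m x y / (3 * e)"
    using assms(3) unfolding K_def by simp
  then have K: "real k * (3 * e) \<le> mdist m x y" if "k \<le> K" for k
    using assms(3) that by (smt (verit, best) of_nat_mono pos_le_divide_eq)
  have "\<exists>c\<in>C. \<exists>z\<in>mspace m. mdist m x z = real k * (3 * e) \<and> mdist m z c < e" if "k \<le> K" for k
    using ivt[of "real k * (3 * e)"] K[OF that] C(4) assms(3) by fastforce
  then obtain c z where cz: "\<And>k. k \<le> K \<Longrightarrow> c k \<in> C \<and> z k \<in> mspace m \<and>
      mdist m x (z k) = real k * (3 * e) \<and> mdist m (z k) (c k) < e"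
    by metis
  have "inj_on c {..K}"
  proof (rule inj_onI)
    fix k l assume kl: "k \<in> {..K}" "l \<in> {..K}" "c k = c l"
    have "mdist m (z k) (z l) \<le> mdist m (z k) (c k) + mdist m (c k) (z l)"
      using cz kl C(1) by (intro mdist_triangle) auto
    then have "mdist m (z k) (z l) < 2 * e"
      using cz[of k] cz[of l] kl by (simp add: mdist_commute)
    moreover have "mdist m x (z k) \<le> mdist m x (z l) + mdist m (z l) (z k)"
        "mdist m x (z l) \<le> mdist m x (z k) + mdist m (z k) (z l)"
      using cz kl assms(4) by (intro mdist_triangle; simp)+
    \<comment> \<open>Points sharing a net point are less than \<open>2 * e\<close> apart, whereas
      different multiples of \<open>3 * e\<close> differ by at least \<open>3 * e\<close>.\<close>
    ultimately have "\<bar>real k * (3 * e) - real l * (3 * e)\<bar> < 2 * e"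
      using cz[of k] cz[of l] kl by (auto simp: mdist_commute)
    then have "\<bar>real k - real l\<bar> * (3 * e) < 1 * (3 * e)"
      using assms(3) by (simp add: abs_mult left_diff_distrib[symmetric])
    then have "\<bar>real k - real l\<bar> < 1"
      using assms(3) by (subst (asm) mult_less_cancel_right) auto
    then show "k = l"
      by linarith
  qed
  moreover have "c ` {..K} \<subseteq> C"
    using cz by auto
  ultimately have "Suc K \<le> card C"
    using card_inj_on_le[of c "{..K}" C] C(2) by simp
  then have "Suc K \<le> N"
    using C(3) by simp
  moreover have "mdist m x y / (3 * e) < real (Suc K)"
    unfolding K_def by (simp add: assms(3)) linarith
  ultimately have "mdist m x y / (3 * e) \<le> N"
    by linarith
  then show ?thesis
    using assms(3) by (simp add: field_simps)
qed

section \<open>Connectedness and nets of the completion\<close>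

lemma mcompletion_embed_in_mspace:
  assumes "x \<in> mspace m"
  shows "mcompletion_embed m x \<in> mspace (mcompletion m)"
proof -
  have "mcompletion_embed m ` mspace m \<subseteq> mspace (funspace (mspace m) euclidean_metric)"
    by (intro image_subsetI mcompletion_embed_in_funspace)
  then have "mcompletion_embed m ` mspace m \<subseteq>
      mtopology_of (funspace (mspace m) euclidean_metric) closure_of (mcompletion_embed m ` mspace m)"
    by (intro closure_of_subset) (simp del: mspace_funspace)
  with assms show ?thesis
    using mcompletion_embed_in_funspace[OF assms]
    by (auto simp: mcompletion_def simp del: mspace_funspace mdist_funspace)
qed

lemma mcompletion_approx:
  assumes "y \<in> mspace (mcompletion m)" "e > 0"
  obtains x where "x \<in> mspace m" "mdist (mcompletion m) y (mcompletion_embed m x) < e"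
proof -
  interpret Metric_space "mspace (mcompletion m)" "mdist (mcompletion m)"
    by (rule Metric_space_mspace_mdist)
  have "y \<in> mtopology closure_of (mcompletion_embed m ` mspace m)"
    using assms(1) mcompletion_dense[of m] by (simp add: mtopology_of_def)
  then show ?thesis
    using that assms(2) unfolding metric_closure_of by fastforce
qed

text \<open>The embedding is isometric, hence continuous, so its image is connected; the completion
  is the closure of that image.\<close>

lemma connected_mcompletion:
  assumes "connected_space (mtopology_of m)"
  shows "connected_space (mtopology_of (mcompletion m))"
proof -
  have "Lipschitz_continuous_map m (mcompletion m) (mcompletion_embed m)"
    unfolding Lipschitz_continuous_map_def
    by (auto simp: mcompletion_embed_in_mspace mdist_mcompletion_embed intro!: exI[of _ 1])
  then have "connectedin (mtopology_of (mcompletion m)) (mcompletion_embed m ` mspace m)"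
    using assms by (metis Lipschitz_continuous_imp_continuous_map connectedin_continuous_map_image
        connectedin_topspace topspace_mtopology_of)
  then have "connectedin (mtopology_of (mcompletion m)) (mspace (mcompletion m))"
    using connectedin_closure_of mcompletion_dense by metis
  then show ?thesis
    by (metis connectedin_topspace topspace_mtopology_of)
qed

text \<open>The infimum over an empty family of curves is infinite, but distances are finite. So any
  two points are joined by a curve.\<close>

lemma length_metric_imp_connected:
  assumes "length_metric m"
  shows "connected_space (mtopology_of m)"
proof -
  have "\<exists>g. pathin (mtopology_of m) g \<and> g 0 = x \<and> g 1 = y" if "x \<in> mspace m" "y \<in> mspace m" for x y
  proof (rule ccontr)
    assume "\<not> ?thesis"
    then have "{\<gamma>. pathin (mtopology_of m) \<gamma> \<and> \<gamma> 0 = x \<and> \<gamma> 1 = y} = {}"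
      by blast
    moreover have "ereal (mdist m x y) =
        (INF \<gamma>\<in>{\<gamma>. pathin (mtopology_of m) \<gamma> \<and> \<gamma> 0 = x \<and> \<gamma> 1 = y}. curve_length m \<gamma>)"
      using assms that unfolding length_metric_def by blast
    ultimately show False
      by (simp only: image_empty Inf_empty top_ereal_def) simp
  qed
  then show ?thesis
    by (intro path_connected_imp_connected_space) (simp add: path_connected_space_def)
qed

lemma mcompletion_net_from_inner_region:
  assumes "d > 0"
    and "has_net (submetric (mcompletion m) (closed_inner_region m d)) e N1"
    and "has_net (submetric (mcompletion m) (mboundary m)) e N2"
  shows "has_net (mcompletion m) (2 * d + e) (N1 + N2)"
proof -
  let ?M = "mcompletion m"
  obtain C1 where C1: "C1 \<subseteq> closed_inner_region m d" "C1 \<subseteq> mspace ?M" "finite C1" "card C1 \<le> N1"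
    "\<forall>x\<in>closed_inner_region m d \<inter> mspace ?M. \<exists>c\<in>C1. mdist ?M x c < e"
    using assms(2) unfolding has_net_def by auto
  obtain C2 where C2: "C2 \<subseteq> mspace ?M" "finite C2" "card C2 \<le> N2"
    "\<forall>x\<in>mboundary m \<inter> mspace ?M. \<exists>c\<in>C2. mdist ?M x c < e"
    using assms(3) unfolding has_net_def by auto
  have bd: "mboundary m \<subseteq> mspace ?M"
    by (auto simp: mboundary_def)
  have "\<exists>c\<in>C1 \<union> C2. mdist ?M y c < 2 * d + e" if y: "y \<in> mspace ?M" for y
  proof (cases "y \<in> mboundary m")
    case True
    then obtain c where "c \<in> C2" "mdist ?M y c < e"
      using C2(4) y by blast
    then show ?thesis
      using assms(1) by (intro bexI[of _ c]) auto
  next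
    case False
    then obtain x where x: "x \<in> mspace m" "y = mcompletion_embed m x"
      using y by (auto simp: mboundary_def)
    show ?thesis
    proof (cases "x \<in> inner_region m d")
      case True
      have "mcompletion_embed m ` inner_region m d \<subseteq> closed_inner_region m d"
        unfolding closed_inner_region_def
        by (intro closure_of_subset) (auto simp: inner_region_def mcompletion_embed_in_mspace)
      then have "y \<in> closed_inner_region m d"
        using x True by blast
      then obtain c where "c \<in> C1" "mdist ?M y c < e"
        using C1(5) y by blast
      then show ?thesis
        using assms(1) by (intro bexI[of _ c]) auto
    next
      case False
      \<comment> \<open>The infimum is at most \<open>d\<close> but need not be attained; the slack
        in \<open>2 * d\<close> yields an actual boundary point. With an empty boundary the infimum
        is infinite and this case does not arise.\<close>
      then have "(INF b\<in>mboundary m. ereal (mdist ?M y b)) < ereal (2 * d)"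
        using x assms(1) by (auto simp: inner_region_def not_less intro: le_less_trans)
      then obtain b where b: "b \<in> mboundary m" "mdist ?M y b < 2 * d"
        by (auto simp: INF_less_iff)
      then obtain c where c: "c \<in> C2" "mdist ?M b c < e"
        using C2(4) bd by blast
      have "mdist ?M y c \<le> mdist ?M y b + mdist ?M b c"
        using y b c bd C2(1) by (intro mdist_triangle) auto
      then show ?thesis
        using b c by (intro bexI[of _ c]) auto
    qed
  qed
  moreover have "card (C1 \<union> C2) \<le> N1 + N2"
    using card_Un_le[of C1 C2] C1(4) C2(3) by linarith
  ultimately show ?thesis
    unfolding has_net_def using C1 C2 by (intro exI[of _ "C1 \<union> C2"]) auto
qed

section \<open>Nets under Gromov-Hausdorff convergence\<close>

lemma GH_dist_nonneg: "0 \<le> GH_dist m1 m2"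
  unfolding GH_dist_def Hausdorff_dist_def by (auto intro!: Inf_greatest)

text \<open>Net points of \<open>m2\<close> are moved by \<open>h\<close> to points of
  \<open>m1\<close> closer than \<open>s < r\<close> in a common space. Their number does not grow;
  the radius gains one \<open>r\<close> for passing from \<open>m1\<close> to \<open>m2\<close> and
  one for coming back.\<close>

lemma GH_dist_less_net:
  fixes m1 :: "'a metric" and m2 :: "'b metric"
  assumes "GH_dist m1 m2 < ereal r" "has_net m2 e N"
  shows "has_net m1 (2 * r + e) N"
proof -
  obtain Z :: "('a + 'b) metric" and f g where iso: "isometric_embedding m1 Z f" "isometric_embedding m2 Z g"
    and "Hausdorff_dist Z (f ` mspace m1) (g ` mspace m2) < ereal r"
    using assms(1) unfolding GH_dist_def Inf_less_iff by auto
  then obtain s where s: "s < r" "\<forall>a\<in>mspace m1. \<exists>b\<in>mspace m2. mdist Z (f a) (g b) < s"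
     "\<forall>b\<in>mspace m2. \<exists>a\<in>mspace m1. mdist Z (f a) (g b) < s"
    unfolding Hausdorff_dist_def Inf_less_iff by auto
  obtain h where h: "\<And>b. b \<in> mspace m2 \<Longrightarrow> h b \<in> mspace m1 \<and> mdist Z (f (h b)) (g b) < s"
    using s(3) by metis
  obtain C where C: "C \<subseteq> mspace m2" "finite C" "card C \<le> N" "\<forall>x\<in>mspace m2. \<exists>c\<in>C. mdist m2 x c < e"
    using assms(2) unfolding has_net_def by blast
  have f: "f a \<in> mspace Z" if "a \<in> mspace m1" for a
    using iso that by (auto simp: isometric_embedding_def)
  have g: "g b \<in> mspace Z" if "b \<in> mspace m2" for b
    using iso that by (auto simp: isometric_embedding_def)
  have "\<exists>c\<in>h ` C. mdist m1 a c < 2 * r + e" if a: "a \<in> mspace m1" for a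
  proof -
    obtain b where b: "b \<in> mspace m2" "mdist Z (f a) (g b) < s"
      using s a by blast
    obtain c where c: "c \<in> C" "c \<in> mspace m2" "mdist m2 b c < e"
      using C b by blast
    have "mdist m1 a (h c) = mdist Z (f a) (f (h c))"
      using iso a h[OF c(2)] by (simp add: isometric_embedding_def)
    also have "\<dots> \<le> mdist Z (f a) (g b) + mdist Z (g b) (f (h c))"
      using f g a b c h by (intro mdist_triangle) auto
    also have "mdist Z (g b) (f (h c)) \<le> mdist Z (g b) (g c) + mdist Z (g c) (f (h c))"
      using f g a b c h by (intro mdist_triangle) auto
    also have "mdist Z (g b) (g c) = mdist m2 b c"
      using iso b c by (simp add: isometric_embedding_def)
    finally show ?thesis
      using b c h[OF c(2)] s(1) by (intro bexI[of _ "h c"]) (auto simp: mdist_commute)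
  qed
  moreover have "h ` C \<subseteq> mspace m1" "card (h ` C) \<le> N"
    using C h card_image_le[of C h] by auto
  ultimately show ?thesis
    unfolding has_net_def using C(2) by (intro exI[of _ "h ` C"]) auto
qed

lemma GH_converges_eventually_net:
  assumes "GH_converges X Y" "compact_space (mtopology_of Y)" "e > 0"
  shows "\<exists>N. \<forall>\<^sub>F j in sequentially. has_net (X j) e N"
proof -
  obtain N where N: "has_net Y (e / 2) N"
    using compact_has_net assms by (metis half_gt_zero)
  \<comment> \<open>The constants fit: \<open>2 * (e / 4) + e / 2 = e\<close>.\<close>
  have "\<forall>\<^sub>F j in sequentially. GH_dist (X j) Y < ereal (e / 4)"
    using assms unfolding GH_converges_def by (intro order_tendstoD) auto
  then have "\<forall>\<^sub>F j in sequentially. has_net (X j) e N"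
    by eventually_elim (use GH_dist_less_net[OF _ N] in force)
  then show ?thesis ..
qed

text \<open>Only finitely many spaces escape the common bound \<open>N\<close>; each has a finite
  net by compactness, and the maximum of the sizes works for all.\<close>

lemma compact_eventually_net_imp_net:
  assumes "\<And>j. compact_space (mtopology_of (X j))" "e > 0"
    and "\<forall>\<^sub>F j in sequentially. has_net (X j) e N"
  shows "\<exists>N. \<forall>j. has_net (X j) e N"
proof -
  obtain J where J: "\<And>j. j \<ge> J \<Longrightarrow> has_net (X j) e N"
    using assms(3) by (auto simp: eventually_sequentially)
  obtain n where n: "\<And>j. has_net (X j) e (n j)"
    using compact_has_net[OF assms(1,2)] by metis
  have "has_net (X j) e (Max (insert N (n ` {..<J})))" for j
    by (cases "j < J") (auto intro: has_net_mono[OF n] has_net_mono[OF J])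
  then show ?thesis
    by blast
qed

section \<open>Gluing two spaces along a finite correspondence\<close>

lemma mdist_self: "x \<in> mspace m \<Longrightarrow> mdist m x x = 0"
  by simp

text \<open>The gluing metric on the disjoint union: cross distances go through a pair
  \<open>(p k, q k)\<close> of corresponding points at distance \<open>r\<close>.\<close>

lemma GH_dist_le_correspondence:
  fixes A :: "'a metric" and B :: "'b metric"
  assumes I: "finite I" "I \<noteq> {}" and r: "r > 0"
    and p: "\<And>k. k \<in> I \<Longrightarrow> p k \<in> mspace A" and q: "\<And>k. k \<in> I \<Longrightarrow> q k \<in> mspace B"
    and dist: "\<And>k l. k \<in> I \<Longrightarrow> l \<in> I \<Longrightarrow> \<bar>mdist A (p k) (p l) - mdist B (q k) (q l)\<bar> \<le> 2 * r"
    and netA: "\<And>x. x \<in> mspace A \<Longrightarrow> \<exists>k\<in>I. mdist A x (p k) < e"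
    and netB: "\<And>y. y \<in> mspace B \<Longrightarrow> \<exists>k\<in>I. mdist B y (q k) < e"
  shows "GH_dist A B \<le> ereal (e + r)"
proof -
  \<comment> \<open>The cheapest crossing from \<open>a\<close> to \<open>b\<close>. The summand
    \<open>r\<close> keeps it positive, so the two spaces stay disjoint in the glued metric.\<close>
  define h where "h a b = Min ((\<lambda>k. mdist A a (p k) + r + mdist B (q k) b) ` I)" for a b
  define d where "d u v = (case u of
      Inl a \<Rightarrow> (case v of Inl a' \<Rightarrow> mdist A a a' | Inr b \<Rightarrow> h a b)
    | Inr b \<Rightarrow> (case v of Inl a \<Rightarrow> h a b | Inr b' \<Rightarrow> mdist B b b'))" for u v :: "'a + 'b"
  have d_simps [simp]: "d (Inl a) (Inl a') = mdist A a a'" "d (Inl a) (Inr b) = h a b"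
    "d (Inr b) (Inl a) = h a b" "d (Inr b) (Inr b') = mdist B b b'" for a a' b b'
    by (simp_all add: d_def)
  have h_le: "h a b \<le> mdist A a (p k) + r + mdist B (q k) b" if "k \<in> I" for a b k
    unfolding h_def using that I by (intro Min_le) auto
  have h_eq: "\<exists>k\<in>I. h a b = mdist A a (p k) + r + mdist B (q k) b" for a b
  proof -
    have "h a b \<in> (\<lambda>k. mdist A a (p k) + r + mdist B (q k) b) ` I"
      unfolding h_def using I by (intro Min_in) auto
    then show ?thesis by blast
  qed
  have h_pos: "0 < h a b" for a b
    using h_eq[of a b] r by (metis add_nonneg_pos add_pos_nonneg mdist_nonneg)
  have triA: "mdist A x z \<le> mdist A x y + mdist A y z"
    if "x \<in> mspace A" "y \<in> mspace A" "z \<in> mspace A" for x y z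
    using that by (rule mdist_triangle)
  have triB: "mdist B x z \<le> mdist B x y + mdist B y z"
    if "x \<in> mspace B" "y \<in> mspace B" "z \<in> mspace B" for x y z
    using that by (rule mdist_triangle)
  have AAB: "h a b \<le> mdist A a a' + h a' b" if "a \<in> mspace A" "a' \<in> mspace A" for a a' b
    using h_eq[of a' b] h_le[of _ a b] triA[OF that] p by fastforce
  have ABB: "h a b \<le> h a b' + mdist B b' b" if "b \<in> mspace B" "b' \<in> mspace B" for a b b'
    using h_eq[of a b'] h_le[of _ a b] triB[OF _ that(2,1)] q by fastforce
  \<comment> \<open>A detour through the other space crosses twice and so pays \<open>2 * r\<close>,
    which is exactly the distortion allowed by \<open>dist\<close>.\<close>
  have ABA: "mdist A a a' \<le> h a b + h a' b"
    if ab: "a \<in> mspace A" "a' \<in> mspace A" "b \<in> mspace B" for a a' b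
  proof -
    obtain k where k: "k \<in> I" "h a b = mdist A a (p k) + r + mdist B (q k) b" using h_eq by blast
    obtain l where l: "l \<in> I" "h a' b = mdist A a' (p l) + r + mdist B (q l) b" using h_eq by blast
    show ?thesis
      using triA[OF ab(1) p[OF k(1)] ab(2)] triA[OF p[OF k(1)] p[OF l(1)] ab(2)]
        triB[OF q[OF k(1)] ab(3) q[OF l(1)]] dist[OF k(1) l(1)] k(2) l(2)
      by (simp add: mdist_commute)
  qed
  have BAB: "mdist B b b' \<le> h a b + h a b'"
    if ab: "a \<in> mspace A" "b \<in> mspace B" "b' \<in> mspace B" for a b b'
  proof -
    obtain k where k: "k \<in> I" "h a b = mdist A a (p k) + r + mdist B (q k) b" using h_eq by blast
    obtain l where l: "l \<in> I" "h a b' = mdist A a (p l) + r + mdist B (q l) b'" using h_eq by blast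
    show ?thesis
      using triB[OF ab(2) q[OF k(1)] ab(3)] triB[OF q[OF k(1)] q[OF l(1)] ab(3)]
        triA[OF p[OF k(1)] ab(1) p[OF l(1)]] dist[OF k(1) l(1)] k(2) l(2)
      by (simp add: mdist_commute)
  qed
  have BAA: "h a b \<le> h a' b + mdist A a' a" if "a \<in> mspace A" "a' \<in> mspace A" for a a' b
    using AAB[OF that] by (simp add: mdist_commute add.commute)
  have BBA: "h a b \<le> mdist B b b' + h a b'" if "b \<in> mspace B" "b' \<in> mspace B" for a b b'
    using ABB[OF that] by (simp add: mdist_commute add.commute)
  let ?S = "Inl ` mspace A \<union> Inr ` mspace B"
  interpret Metric_space ?S d
  proof
    show "0 \<le> d u v" for u v
      by (cases u; cases v) (auto simp: h_pos less_imp_le)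
    show "d u v = d v u" for u v
      by (cases u; cases v) (auto simp: mdist_commute)
    show "d u v = 0 \<longleftrightarrow> u = v" if "u \<in> ?S" "v \<in> ?S" for u v
      using that h_pos by (auto simp: less_imp_neq[OF h_pos, symmetric])
    show "d u w \<le> d u v + d v w" if "u \<in> ?S" "v \<in> ?S" "w \<in> ?S" for u v w
      using that triA triB AAB ABB ABA BAB BAA BBA by auto
  qed
  have iso: "isometric_embedding A (metric (?S, d)) Inl" "isometric_embedding B (metric (?S, d)) Inr"
    by (auto simp: isometric_embedding_def)
  \<comment> \<open>Crossing at the index \<open>k\<close> and stopping at \<open>q k\<close> costs
    nothing beyond \<open>mdist A a (p k) + r\<close>.\<close>
  have "h a b < e + r" if "k \<in> I" "b = q k" "mdist A a (p k) < e" for a b k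
    using h_le[OF that(1), of a b] mdist_self[OF q, of k] that by simp
  then have 1: "\<exists>b\<in>mspace B. h a b < e + r" if "a \<in> mspace A" for a
    using netA[OF that] q by blast
  have "h a b < e + r" if "k \<in> I" "a = p k" "mdist B b (q k) < e" for a b k
    using h_le[OF that(1), of a b] mdist_self[OF p, of k] that by (simp add: mdist_commute)
  then have 2: "\<exists>a\<in>mspace A. h a b < e + r" if "b \<in> mspace B" for b
    using netB[OF that] p by blast
  \<comment> \<open>Positivity of \<open>e\<close> is not assumed but follows from the net property
    at some \<open>p k\<close>.\<close>
  obtain k where "k \<in> I"
    using I by blast
  then obtain l where "mdist A (p k) (p l) < e"
    using netA p by blast
  then have "0 < e"
    by (metis le_less_trans mdist_nonneg)
  then have "Hausdorff_dist (metric (?S, d)) (Inl ` mspace A) (Inr ` mspace B) \<le> ereal (e + r)"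
    using 1 2 r unfolding Hausdorff_dist_def by (intro Inf_lower) auto
  moreover have "GH_dist A B \<le> Hausdorff_dist (metric (?S, d)) (Inl ` mspace A) (Inr ` mspace B)"
    unfolding GH_dist_def by (rule Inf_lower) (use iso in blast)
  ultimately show ?thesis
    by order
qed

section \<open>Limit space and Gromov's precompactness criterion\<close>

text \<open>Gromov-Hausdorff limits have to be metrics on \<^typ>\<open>nat \<Rightarrow> real\<close>. Choosing one representative
  per class of a pseudometric on \<^typ>\<open>nat\<close> avoids the quotient, and the completion of
  the set of representatives has the right carrier type.\<close>

lemma mcompletion_of_pseudometric:
  fixes \<rho> :: "'a::wellorder \<Rightarrow> 'a \<Rightarrow> real"
  assumes refl: "\<And>k. \<rho> k k = 0" and sym: "\<And>k l. \<rho> k l = \<rho> l k"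
    and tri: "\<And>k l n. \<rho> k n \<le> \<rho> k l + \<rho> l n"
  obtains Y :: "('a \<Rightarrow> real) metric" and q where "mcomplete_of Y" "\<And>k. q k \<in> mspace Y"
    "\<And>k l. mdist Y (q k) (q l) = \<rho> k l"
    "\<And>y e. y \<in> mspace Y \<Longrightarrow> e > 0 \<Longrightarrow> \<exists>k. mdist Y y (q k) < e"
proof -
  define rep where "rep k = (LEAST l. \<rho> l k = 0)" for k
  have nonneg: "0 \<le> \<rho> k l" for k l
    using tri[of k k l] sym[of k l] by (simp add: refl)
  have rep: "\<rho> (rep k) k = 0" for k
    unfolding rep_def by (rule LeastI[of _ k]) (rule refl)
  have \<rho>_rep: "\<rho> (rep k) (rep l) = \<rho> k l" for k l
    using tri[of "rep k" "rep l" k] tri[of k "rep l" l] tri[of k l "rep k"] tri[of "rep k" l "rep l"]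
      rep[of k] rep[of l] sym by (smt (verit))
  have rep_eq: "rep k = rep l" if "\<rho> k l = 0" for k l
  proof -
    \<comment> \<open>Points at distance zero have equal distances to every \<open>n\<close>, so the
      two minima range over the same set.\<close>
    have "\<rho> n k = \<rho> n l" for n
      using tri[of n l k] tri[of n k l] that sym[of k l] by linarith
    then show ?thesis
      by (simp add: rep_def)
  qed
  interpret Metric_space "range rep" \<rho>
  proof
    show "\<rho> x y = 0 \<longleftrightarrow> x = y" if "x \<in> range rep" "y \<in> range rep" for x y
      using that refl \<rho>_rep rep_eq by (metis imageE)
  qed (rule nonneg sym tri)+
  let ?m = "metric (range rep, \<rho>)"
  show ?thesis
  proof
    show "mcomplete_of (mcompletion ?m)"
      by (rule mcomplete_of_mcompletion)
    show "mcompletion_embed ?m (rep k) \<in> mspace (mcompletion ?m)" for k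
      by (rule mcompletion_embed_in_mspace) simp
    show "mdist (mcompletion ?m) (mcompletion_embed ?m (rep k)) (mcompletion_embed ?m (rep l)) = \<rho> k l"
      for k l
      by (subst mdist_mcompletion_embed) (auto simp: \<rho>_rep)
    show "\<exists>k. mdist (mcompletion ?m) y (mcompletion_embed ?m (rep k)) < e"
      if "y \<in> mspace (mcompletion ?m)" "e > 0" for y e
      using mcompletion_approx[OF that] by (metis imageE mspace_metric)
  qed
qed

text \<open>The bound \<open>D\<close> keeps all distance sequences bounded, and net sizes
  independent of \<open>j\<close> let one finite index set serve all spaces and the limit.\<close>

theorem Gromov_precompactness:
  fixes M :: "nat \<Rightarrow> 'a metric"
  assumes ne: "\<And>j. mspace (M j) \<noteq> {}"
    and bdd: "\<And>j x y. x \<in> mspace (M j) \<Longrightarrow> y \<in> mspace (M j) \<Longrightarrow> mdist (M j) x y \<le> D"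
    and nets: "\<And>e. e > 0 \<Longrightarrow> \<exists>N. \<forall>j. has_net (M j) e N"
  shows "\<exists>r :: nat \<Rightarrow> nat. strict_mono r \<and> GH_convergent (\<lambda>k. M (r k))"
proof -
  define \<epsilon> where "\<epsilon> n = inverse (real (Suc n))" for n
  have \<epsilon>: "\<epsilon> n > 0" for n
    by (simp add: \<epsilon>_def)
  obtain N where N: "\<And>n j. has_net (M j) (\<epsilon> n) (N n)"
    using nets[OF \<epsilon>] by metis
  have "\<exists>c. (\<forall>i. c i \<in> mspace (M j)) \<and>
      (\<forall>x\<in>mspace (M j). \<exists>i<N n. mdist (M j) x (c i) < \<epsilon> n)" for j n
  proof -
    obtain C where C: "C \<subseteq> mspace (M j)" "finite C" "card C \<le> N n"
      "\<forall>x\<in>mspace (M j). \<exists>c\<in>C. mdist (M j) x c < \<epsilon> n"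
      using N[of j n] unfolding has_net_def by blast
    obtain f where f: "C = f ` {..<card C}"
      using C(2) by (metis atLeast0LessThan bij_betw_def ex_bij_betw_nat_finite)
    obtain a where a: "a \<in> mspace (M j)"
      using ne by blast
    \<comment> \<open>Smaller nets are padded with the point \<open>a\<close>, so that the indices
      below \<open>N n\<close> serve every \<open>j\<close>.\<close>
    define c where "c i = (if i < card C then f i else a)" for i
    have "c i \<in> mspace (M j)" for i
      using C(1) f a by (auto simp: c_def)
    moreover have "\<exists>i<N n. mdist (M j) x (c i) < \<epsilon> n" if x: "x \<in> mspace (M j)" for x
    proof -
      obtain y where "y \<in> C" "mdist (M j) x y < \<epsilon> n"
        using C(4) x by blast
      moreover then obtain i where "i < card C" "y = f i"
        using f by blast
      ultimately show ?thesis
        using C(3) by (intro exI[of _ i]) (auto simp: c_def)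
    qed
    ultimately show ?thesis
      by blast
  qed
  then obtain c where c: "\<And>j n i. c j n i \<in> mspace (M j)"
    and c_net: "\<And>j n x. x \<in> mspace (M j) \<Longrightarrow> \<exists>i<N n. mdist (M j) x (c j n i) < \<epsilon> n"
    by metis
  \<comment> \<open>All levels are merged into one sequence of points per space. The block
    \<open>I n\<close> holds the indices of level \<open>n\<close> and does not depend on
    \<open>j\<close>.\<close>
  define p where "p j k = (case prod_decode k of (n, i) \<Rightarrow> c j n i)" for j k
  define I where "I n = (\<lambda>i. prod_encode (n, i)) ` {..<N n}" for n
  have p: "p j k \<in> mspace (M j)" for j k
    by (auto simp: p_def c split: prod.split)
  have p_net: "\<exists>k\<in>I n. mdist (M j) x (p j k) < \<epsilon> n" if "x \<in> mspace (M j)" for j n x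
    using c_net[OF that, of n] by (auto simp: p_def I_def)
  have finI: "finite (I n)" and neI: "I n \<noteq> {}" for n
    using p_net[OF p] by (auto simp: I_def)
  \<comment> \<open>Pairs of indices form a countable set, so a diagonal subsequence makes all
    mutual distances converge at once.\<close>
  define f where "f j u = mdist (M j) (p j (fst u)) (p j (snd u))" for j u
  have "norm (f j u) \<le> D" for j u
    using bdd p by (simp add: f_def)
  then obtain r where r: "strict_mono r" and lim: "\<And>u. \<exists>l. (\<lambda>j. f (r j) u) \<longlonglongrightarrow> l"
    using function_convergent_subsequence[of UNIV f D] by (metis UNIV_I countableI_type)
  have "\<exists>d. (\<lambda>j. mdist (M (r j)) (p (r j) k) (p (r j) l)) \<longlonglongrightarrow> d" for k l
    using lim[of "(k, l)"] by (simp add: f_def)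
  then obtain \<rho> where \<rho>: "\<And>k l. (\<lambda>j. mdist (M (r j)) (p (r j) k) (p (r j) l)) \<longlonglongrightarrow> \<rho> k l"
    by metis
  obtain Y :: "(nat \<Rightarrow> real) metric" and q where Y: "mcomplete_of Y" "\<And>k. q k \<in> mspace Y"
    "\<And>k l. mdist Y (q k) (q l) = \<rho> k l"
    "\<And>y e. y \<in> mspace Y \<Longrightarrow> e > 0 \<Longrightarrow> \<exists>k. mdist Y y (q k) < e"
  proof (rule mcompletion_of_pseudometric[of \<rho>])
    show "\<rho> k k = 0" for k
      using \<rho>[of k k] mdist_self[OF p] by (simp add: LIMSEQ_const_iff)
    show "\<rho> k l = \<rho> l k" for k l
      using \<rho>[of k l] \<rho>[of l k] LIMSEQ_unique by (simp add: mdist_commute) blast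
    show "\<rho> k n \<le> \<rho> k l + \<rho> l n" for k l n
      by (rule LIMSEQ_le[OF \<rho> tendsto_add[OF \<rho> \<rho>]]) (use p in \<open>auto intro!: mdist_triangle\<close>)
  qed (rule that)
  \<comment> \<open>If every index of the finite block failed in the limit, all would fail
    simultaneously for some \<open>j\<close>, against the net property of
    \<open>M (r j)\<close>.\<close>
  have \<rho>_net: "\<exists>i\<in>I n. \<rho> k i \<le> \<epsilon> n" for k n
  proof (rule ccontr)
    assume "\<not> ?thesis"
    then have "\<forall>\<^sub>F j in sequentially. \<forall>i\<in>I n. mdist (M (r j)) (p (r j) k) (p (r j) i) > \<epsilon> n"
      using order_tendstoD(1)[OF \<rho>] by (intro eventually_ball_finite[OF finI] ballI) (auto simp: not_le)
    then obtain j where "\<forall>i\<in>I n. mdist (M (r j)) (p (r j) k) (p (r j) i) > \<epsilon> n"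
      using eventually_happens'[OF sequentially_bot] by blast
    then show False
      using p_net[OF p, of n "r j" k] by fastforce
  qed
  \<comment> \<open>One \<open>\<epsilon> n\<close> approximates \<open>y\<close> by some
    \<open>q k\<close>, the other is the net radius for \<open>\<rho>\<close>.\<close>
  have Y_net: "\<exists>i\<in>I n. mdist Y y (q i) < 2 * \<epsilon> n" if y: "y \<in> mspace Y" for y n
  proof -
    obtain k where k: "mdist Y y (q k) < \<epsilon> n"
      using Y(4)[OF y \<epsilon>] by blast
    obtain i where i: "i \<in> I n" "\<rho> k i \<le> \<epsilon> n"
      using \<rho>_net by blast
    have "mdist Y y (q i) \<le> mdist Y y (q k) + mdist Y (q k) (q i)"
      using y Y(2) by (intro mdist_triangle) auto
    then show ?thesis
      using k i Y(3) by (intro bexI[of _ i]) auto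
  qed
  have small: "\<exists>n. 3 * \<epsilon> n < e" if "e > 0" for e
  proof -
    obtain n where "\<epsilon> n < e / 3"
      unfolding \<epsilon>_def using reals_Archimedean[of "e / 3"] \<open>e > 0\<close> by auto
    then show ?thesis
      by (intro exI[of _ n]) simp
  qed
  have "compact_space (mtopology_of Y)"
  proof (rule compact_if_nets[OF Y(1)])
    fix e :: real assume "e > 0"
    then obtain n where n: "3 * \<epsilon> n < e"
      using small by blast
    then have "2 * \<epsilon> n < e"
      using \<epsilon>[of n] by simp
    then have "\<forall>y\<in>mspace Y. \<exists>x\<in>q ` I n. mdist Y y x < e"
      using Y_net[of _ n] by (meson image_eqI order_less_trans)
    then show "\<exists>N. has_net Y e N"
      unfolding has_net_def using finI Y(2) by (intro exI[of _ "card (q ` I n)"] exI[of _ "q ` I n"]) auto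
  qed
  moreover have "GH_converges (\<lambda>j. M (r j)) Y"
    unfolding GH_converges_def
  proof (rule order_tendstoI)
    fix a :: ereal assume "a < 0"
    then show "\<forall>\<^sub>F j in sequentially. a < GH_dist (M (r j)) Y"
      by (intro always_eventually allI order_less_le_trans[OF _ GH_dist_nonneg])
  next
    fix a :: ereal assume "0 < a"
    then obtain e where e: "0 < e" "ereal e < a"
      using ereal_dense2[of 0 a] by auto
    then obtain n where n: "3 * \<epsilon> n < e"
      using small by blast
    have "\<forall>\<^sub>F j in sequentially. \<forall>k\<in>I n. \<forall>l\<in>I n.
        dist (mdist (M (r j)) (p (r j) k) (p (r j) l)) (\<rho> k l) < 2 * \<epsilon> n"
      using \<epsilon>[of n] by (intro eventually_ball_finite[OF finI] ballI tendstoD[OF \<rho>]) auto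
    then show "\<forall>\<^sub>F j in sequentially. GH_dist (M (r j)) Y < a"
    proof eventually_elim
      case (elim j)
      \<comment> \<open>The gluing uses net radius \<open>2 * \<epsilon> n\<close> in both spaces
        and crossing cost \<open>\<epsilon> n\<close>, which permits distortion
        \<open>2 * \<epsilon> n\<close>.\<close>
      have "GH_dist (M (r j)) Y \<le> ereal (2 * \<epsilon> n + \<epsilon> n)"
      proof (rule GH_dist_le_correspondence[OF finI neI \<epsilon> p Y(2)])
        show "\<bar>mdist (M (r j)) (p (r j) k) (p (r j) l) - mdist Y (q k) (q l)\<bar> \<le> 2 * \<epsilon> n"
          if "k \<in> I n" "l \<in> I n" for k l
          using elim that by (auto simp: Y(3) dist_real_def less_imp_le)
        show "\<exists>k\<in>I n. mdist (M (r j)) x (p (r j) k) < 2 * \<epsilon> n" if "x \<in> mspace (M (r j))" for x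
        proof -
          have "\<epsilon> n \<le> 2 * \<epsilon> n"
            using \<epsilon>[of n] by simp
          then show ?thesis
            using p_net[OF that, of n] by (meson order_less_le_trans)
        qed
        show "\<exists>k\<in>I n. mdist Y y (q k) < 2 * \<epsilon> n" if "y \<in> mspace Y" for y
          using Y_net[OF that] .
      qed
      also have "\<dots> < ereal e"
        using n by simp
      finally show ?case
        using e(2) by order
    qed
  qed
  ultimately show ?thesis
    using r unfolding GH_convergent_def by blast
qed

section \<open>Uniform nets and diameter bound for the completions\<close>

theorem theorem1p4:
  fixes X :: "nat \<Rightarrow> 'a metric"
    and \<delta> :: "nat \<Rightarrow> real"
    and X\<delta> :: "nat \<Rightarrow> 'b metric"
    and Xbd :: "'c metric"
  assumes "\<And>j. length_metric (X j)"
    and "\<And>j. precompact_metric (X j)"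
    and "\<And>j. precompact_metric (submetric (mcompletion (X j)) (mboundary (X j)))"
    and "decseq \<delta>"
    and "\<And>i. \<delta> i > 0"
    and "\<delta> \<longlonglongrightarrow> 0"
    and "\<And>i j. inner_region (X j) (\<delta> i) \<noteq> {}"
    and "\<And>i. compact_space (mtopology_of (X\<delta> i))"
    and "\<And>i. GH_converges
           (\<lambda>j. submetric (mcompletion (X j)) (closed_inner_region (X j) (\<delta> i))) (X\<delta> i)"
    and "compact_space (mtopology_of Xbd)"
    and "GH_converges (\<lambda>j. submetric (mcompletion (X j)) (mboundary (X j))) Xbd"
  shows "\<exists>r :: nat \<Rightarrow> nat. strict_mono r \<and> GH_convergent (\<lambda>k. mcompletion (X (r k)))"
proof -
  have nets: "\<exists>N. \<forall>j. has_net (mcompletion (X j)) e N" if e: "e > 0" for e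
  proof -
    \<comment> \<open>With \<open>\<delta> i < e / 4\<close> the combined radius
      \<open>2 * \<delta> i + e / 2\<close> stays below \<open>e\<close>.\<close>
    have "\<forall>\<^sub>F i in sequentially. \<delta> i < e / 4"
      using assms(6) that by (intro order_tendstoD) auto
    then obtain i where i: "\<delta> i < e / 4"
      by (metis eventually_happens trivial_limit_sequentially)
    obtain N1 where N1: "\<forall>\<^sub>F j in sequentially.
        has_net (submetric (mcompletion (X j)) (closed_inner_region (X j) (\<delta> i))) (e / 2) N1"
      using GH_converges_eventually_net[OF assms(9,8) half_gt_zero[OF e]] by blast
    obtain N2 where N2: "\<forall>\<^sub>F j in sequentially.
        has_net (submetric (mcompletion (X j)) (mboundary (X j))) (e / 2) N2"
      using GH_converges_eventually_net[OF assms(11,10) half_gt_zero[OF e]] by blast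
    have "\<forall>\<^sub>F j in sequentially. has_net (mcompletion (X j)) e (N1 + N2)"
      using N1 N2
    proof eventually_elim
      case (elim j)
      then have "has_net (mcompletion (X j)) (2 * \<delta> i + e / 2) (N1 + N2)"
        by (rule mcompletion_net_from_inner_region[OF assms(5)])
      then show ?case
        by (rule has_net_mono) (use i in auto)
    qed
    then show ?thesis
      by (rule compact_eventually_net_imp_net[rotated 2]) (use assms(2) that in \<open>auto simp: precompact_metric_def\<close>)
  qed
  \<comment> \<open>A net at the single scale \<open>1\<close> suffices for a diameter bound uniform
    in \<open>j\<close>.\<close>
  then obtain N where "\<And>j. has_net (mcompletion (X j)) 1 N"
    by (metis zero_less_one)
  then have "mdist (mcompletion (X j)) x y \<le> 3 * 1 * real N"
    if "x \<in> mspace (mcompletion (X j))" "y \<in> mspace (mcompletion (X j))" for j x y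
    using connected_net_diameter[OF connected_mcompletion[OF length_metric_imp_connected[OF assms(1)]]]
      that by (metis zero_less_one)
  \<comment> \<open>A point of an inner region witnesses that the completion is nonempty.\<close>
  moreover have "mspace (mcompletion (X j)) \<noteq> {}" for j
    using assms(7)[of j 0] mcompletion_embed_in_mspace by (fastforce simp: inner_region_def)
  ultimately show ?thesis
    using nets by (intro Gromov_precompactness[of "\<lambda>j. mcompletion (X j)"]) auto
qed

end
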